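(* Let $n=k+m$ with integers $k\ge m\ge 1$, and consider the two-block voting chain with parameters $\alpha_A,\alpha_B\in(0,1]$ and $\lambda_A,\lambda_B\in[0,1]$ (with $\lambda_X=1$ if block $X$ is a singleton), as defined in the context. Define the delegation odds of block $X\in\{A,B\}$ by $r_X=\frac{1-\alpha_X}{\alpha_X}$. Then the chain resolves to the minority letter $p_B$ (that is, $M_B>M_A$) if and only if $$n\,\bigl(r_A\lambda_A-r_B\lambda_B\bigr)>k-m.$$
   Context: Two-block voting chain. There are $n=k+m$ voters, split into a block $A$ of $k$ voters and a block $B$ of $m$ voters, with $k\ge m\ge1$, and two policies (answer letters) $p_A$ and $p_B$. All voters of block $A$ pick $p_A$, and all voters of block $B$ pick $p_B$. The voting matrix $V$ is the $(n+2)\times(n+2)$ column-stochastic matrix indexed by the voters and the two policies, where column $j$ is the outgoing distribution of state $j$ (so $V_{i,j}$ is the mass sent from $j$ to $i$). Each policy is absorbing: $V_{p,p}=1$. For $X\in\{A,B\}$, let $Y$ be the other block and $p_X$ the pick of block $X$. Every voter $j\in X$ has the column: - $V_{p_X,j}=\alpha_X$; - $V_{i,j}=(1-\alpha_X)\lambda_X/|Y|$ for every voter $i\in Y$; - $V_{i,j}=(1-\alpha_X)(1-\lambda_X)/(|X|-1)$ for every voter $i\in X$, $i\ne j$; - $V_{j,j}=0$, and $V_{p_Y,j}=0$. Here $\alpha_X\in(0,1]$ is the own-pick confidence of block $X$, and $\lambda_X\in[0,1]$ is its leakage (the fraction of the delegated mass that crosses to the other block). If $|X|=1$ there are no same-block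 peers and $\lambda_X=1$ is required. Let $W^*=\lim_{x\to\infty}V^x$. The total mass absorbed at policy $p_X$ is $M_X=\sum_{j}W^*_{p_X,j}$, with the sum over the $n$ voters $j$. The chain (the Propagational Proxy Voting mechanism, PPV) selects the policy with the largest absorbed mass; it resolves to $p_B$ when $M_B>M_A$. *)

theory Defs
  imports Complex_Main "Jordan_Normal_Form.Matrix"
begin

datatype block = BlockA | BlockB

fun other_block :: "block \<Rightarrow> block" where
  "other_block BlockA = BlockB"
| "other_block BlockB = BlockA"

text \<open>With \<open>n = k + m\<close>, the states are \<open>0, \<dots>, n + 1\<close>: the voters of block \<open>A\<close> come first,
  then the voters of block \<open>B\<close>, then the policies \<open>p\<^sub>A\<close> and \<open>p\<^sub>B\<close>.\<close>

fun block_voters :: "nat \<Rightarrow> nat \<Rightarrow> block \<Rightarrow> nat set" where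
  "block_voters k m BlockA = {0..<k}"
| "block_voters k m BlockB = {k..<k + m}"

fun policy :: "nat \<Rightarrow> nat \<Rightarrow> block \<Rightarrow> nat" where
  "policy k m BlockA = k + m"
| "policy k m BlockB = k + m + 1"

definition block_of :: "nat \<Rightarrow> nat \<Rightarrow> block" where
  "block_of k j = (if j < k then BlockA else BlockB)"

text \<open>Column \<open>j\<close> is the outgoing distribution of state \<open>j\<close>. The same-block case is empty for a
  singleton block, so its zero denominator is never used.\<close>

definition voting_matrix ::
    "nat \<Rightarrow> nat \<Rightarrow> (block \<Rightarrow> real) \<Rightarrow> (block \<Rightarrow> real) \<Rightarrow> real mat" where
  "voting_matrix k m conf leak = mat (k + m + 2) (k + m + 2) (\<lambda>(i, j).
     if j < k + m then
       (let X = block_of k j; Y = other_block X in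
        if i = policy k m X then conf X
        else if i \<in> block_voters k m Y then
          (1 - conf X) * leak X / real (card (block_voters k m Y))
        else if i \<in> block_voters k m X \<and> i \<noteq> j then
          (1 - conf X) * (1 - leak X) / (real (card (block_voters k m X)) - 1)
        else 0)
     else if i = j then 1 else 0)"

text \<open>The matrix limit \<open>W\<^sup>*\<close> of the powers, taken entrywise as the type of matrices carries no
  topology.\<close>

definition limit_matrix ::
    "nat \<Rightarrow> nat \<Rightarrow> (block \<Rightarrow> real) \<Rightarrow> (block \<Rightarrow> real) \<Rightarrow> real mat" where
  "limit_matrix k m conf leak = mat (k + m + 2) (k + m + 2) (\<lambda>(i, j).
     lim (\<lambda>x. (voting_matrix k m conf leak ^\<^sub>m x) $$ (i, j)))"

definition absorbed_mass ::
    "nat \<Rightarrow> nat \<Rightarrow> (block \<Rightarrow> real) \<Rightarrow> (block \<Rightarrow> real) \<Rightarrow> block \<Rightarrow> real" where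
  "absorbed_mass k m conf leak X =
     (\<Sum>j<k + m. limit_matrix k m conf leak $$ (policy k m X, j))"

definition delegation_odds :: "(block \<Rightarrow> real) \<Rightarrow> block \<Rightarrow> real" where
  "delegation_odds conf X = (1 - conf X) / conf X"

end

theory Submission
  imports Defs
begin

text \<open>Row \<open>p\<^sub>P\<close> of the \<open>x\<close>-th power takes one value per block, so the chain lumps to a two-dimensional
  affine recurrence. Its iterates are increasing and bounded, and dividing the fixed-point equation by
  the confidence shows that the limit depends on each block only through \<open>r\<^sub>X \<lambda>\<^sub>X\<close>. With \<open>s\<close> and \<open>t\<close>
  denoting these products for \<open>A\<close> and \<open>B\<close>, solving the \<open>2 \<times> 2\<close> system gives
  \<open>M\<^sub>A = (k + n t) / (1 + s + t)\<close> and \<open>M\<^sub>B = (m + n s) / (1 + s + t)\<close>.\<close>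

text \<open>The probability that a voter of block \<open>X\<close> has reached the policy of
  \<open>P\<close> within \<open>x\<close> steps, by conditioning on the first step. Block sizes do
  not enter: mass delegated to a block is spread uniformly over it.\<close>

fun absorbed_by :: "(block \<Rightarrow> real) \<Rightarrow> (block \<Rightarrow> real) \<Rightarrow> block \<Rightarrow> nat \<Rightarrow> block \<Rightarrow> real" where
  "absorbed_by conf leak P 0 X = 0"
| "absorbed_by conf leak P (Suc x) X = conf X * of_bool (X = P) +
     (1 - conf X) * (leak X * absorbed_by conf leak P x (other_block X)
                     + (1 - leak X) * absorbed_by conf leak P x X)"

lemma voting_matrix_dim:
  "voting_matrix k m conf leak \<in> carrier_mat (k + m + 2) (k + m + 2)"
  by (simp add: voting_matrix_def)

lemma policy_less: "policy k m X < k + m + 2"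
  by (cases X) auto

lemma other_block_neq [simp]: "other_block X \<noteq> X"
  by (cases X) auto

lemma policy_eq_iff [simp]: "policy k m X = policy k m Y \<longleftrightarrow> X = Y"
  by (cases X; cases Y) auto

lemma policy_not_voter [simp]: "policy k m X \<notin> block_voters k m Y"
  by (cases X; cases Y) auto

lemma finite_block_voters [simp]: "finite (block_voters k m X)"
  by (cases X) auto

lemma voter_in_block_of: "j < k + m \<Longrightarrow> j \<in> block_voters k m (block_of k j)"
  by (auto simp: block_of_def)

lemma block_voters_iff: "i \<in> block_voters k m X \<longleftrightarrow> i < k + m \<and> block_of k i = X"
  by (cases X) (auto simp: block_of_def)

text \<open>Splitting relative to an arbitrary \<open>X\<close> lets one column computation serve
  both blocks.\<close>

lemma sum_states:
  fixes f :: "nat \<Rightarrow> real"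
  shows "(\<Sum>i = 0..<k + m + 2. f i) = sum f (block_voters k m X)
    + sum f (block_voters k m (other_block X)) + f (policy k m X) + f (policy k m (other_block X))"
proof -
  have "(\<Sum>i = 0..<k + m + 2. f i) = sum f {0..<k} + sum f {k..<k + m} + f (k + m) + f (k + m + 1)"
    by (simp add: sum.atLeastLessThan_concat)
  then show ?thesis by (cases X) auto
qed

lemma voting_matrix_absorbing_column:
  assumes "k + m \<le> j" "j < k + m + 2" "i < k + m + 2"
  shows "voting_matrix k m conf leak $$ (i, j) = of_bool (i = j)"
  using assms by (simp add: voting_matrix_def)

lemma voting_matrix_voter_column:
  assumes "j \<in> block_voters k m X" "i < k + m + 2"
  shows "voting_matrix k m conf leak $$ (i, j) =
    (if i = policy k m X then conf X
     else if i \<in> block_voters k m (other_block X) then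
       (1 - conf X) * leak X / real (card (block_voters k m (other_block X)))
     else if i \<in> block_voters k m X \<and> i \<noteq> j then
       (1 - conf X) * (1 - leak X) / (real (card (block_voters k m X)) - 1)
     else 0)"
  using assms by (auto simp: voting_matrix_def block_voters_iff Let_def)

text \<open>This is the lumping property: against weights constant on each block, the uniform spread
  cancels the block sizes, so only the values \<open>a\<close> and \<open>b\<close> and the weight
  of the own policy survive.\<close>

lemma sum_voting_matrix_column:
  fixes g :: "nat \<Rightarrow> real"
  assumes pos: "1 \<le> k" "1 \<le> m"
    and single: "\<forall>X. card (block_voters k m X) = 1 \<longrightarrow> leak X = 1"
    and j: "j \<in> block_voters k m X"
    and own: "\<And>i. i \<in> block_voters k m X \<Longrightarrow> g i = a"
    and cross: "\<And>i. i \<in> block_voters k m (other_block X) \<Longrightarrow> g i = b"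
  shows "(\<Sum>i = 0..<k + m + 2. g i * voting_matrix k m conf leak $$ (i, j)) =
    conf X * g (policy k m X) + (1 - conf X) * (leak X * b + (1 - leak X) * a)"
proof -
  let ?V = "\<lambda>i. voting_matrix k m conf leak $$ (i, j)"
  let ?S = "block_voters k m X" and ?T = "block_voters k m (other_block X)"
  note V = voting_matrix_voter_column[OF j]
  have lt: "i < k + m + 2" if "i \<in> block_voters k m Z" for i Z
    using that by (simp add: block_voters_iff)
  have notT: "i \<notin> ?T" if "i \<in> ?S" for i
    using that by (simp add: block_voters_iff other_block_neq[symmetric])
  have notpol: "i \<noteq> policy k m X" if "i \<in> block_voters k m Z" for i Z
    using that by auto
  have cT: "card ?T > 0" using pos by (cases X) auto
  have "(\<Sum>i\<in>?T. g i * ?V i) = (\<Sum>i\<in>?T. b * ((1 - conf X) * leak X / real (card ?T)))"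
    by (rule sum.cong) (use lt notpol V cross in auto)
  then have T: "(\<Sum>i\<in>?T. g i * ?V i) = (1 - conf X) * leak X * b"
    using cT by (simp add: card_gt_0_iff)
  let ?c = "(1 - conf X) * (1 - leak X) / (real (card ?S) - 1)"
  have "(\<Sum>i\<in>?S. g i * ?V i) = (\<Sum>i\<in>?S - {j}. g i * ?V i) + g j * ?V j"
    using j by (simp add: sum.remove)
  also have "?V j = 0" using V[of j] lt[OF j] notT[OF j] notpol[OF j] by simp
  also have "(\<Sum>i\<in>?S - {j}. g i * ?V i) = (\<Sum>i\<in>?S - {j}. a * ?c)"
    by (rule sum.cong) (use lt notpol notT V own in auto)
  also have "\<dots> = (real (card ?S) - 1) * (a * ?c)"
    using j card_Suc_Diff1[OF finite_block_voters j] by simp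
  \<comment> \<open>For a singleton block the left side vanishes through \<open>card ?S - 1\<close>
    and the right side through \<open>leak X = 1\<close>; otherwise the denominator of
    \<open>?c\<close> cancels.\<close>
  also have "\<dots> = (1 - conf X) * (1 - leak X) * a"
    using single[rule_format, of X] by (cases "card ?S = 1") auto
  finally have S: "(\<Sum>i\<in>?S. g i * ?V i) = (1 - conf X) * (1 - leak X) * a" by simp
  have "?V (policy k m X) = conf X" "?V (policy k m (other_block X)) = 0"
    using V[OF policy_less] by simp_all
  then show ?thesis
    unfolding sum_states[of _ k m X] S T by (simp add: algebra_simps)
qed

text \<open>Right multiplication by the voting matrix acts on rows, so the policy row of one power
  determines that of the next. The row is constant on blocks by induction and serves as the weight
  \<open>g\<close> of the column sum.\<close>

lemma voting_matrix_power_row: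
  assumes pos: "1 \<le> k" "1 \<le> m"
    and single: "\<forall>X. card (block_voters k m X) = 1 \<longrightarrow> leak X = 1"
    and "j < k + m + 2"
  shows "(voting_matrix k m conf leak ^\<^sub>m x) $$ (policy k m P, j) =
    (if j < k + m then absorbed_by conf leak P x (block_of k j) else of_bool (j = policy k m P))"
  using assms(4)
proof (induction x arbitrary: j)
  case 0
  have "policy k m P \<ge> k + m" by (cases P) auto
  with 0 policy_less[of k m P] show ?case
    by (auto simp: carrier_matD[OF voting_matrix_dim])
next
  case (Suc x)
  let ?V = "voting_matrix k m conf leak" and ?p = "policy k m P"
  let ?g = "\<lambda>i. (?V ^\<^sub>m x) $$ (?p, i)"
  have dim: "?V ^\<^sub>m x \<in> carrier_mat (k + m + 2) (k + m + 2)"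
    by (rule pow_carrier_mat) (rule voting_matrix_dim)
  have step: "(?V ^\<^sub>m Suc x) $$ (?p, j) = (\<Sum>i = 0..<k + m + 2. ?g i * ?V $$ (i, j))"
    using Suc.prems policy_less[of k m P] carrier_matD[OF dim] carrier_matD[OF voting_matrix_dim[of k m conf leak]]
    by (simp add: scalar_prod_def)
  show ?case
  proof (cases "j < k + m")
    case True
    have g: "?g i = absorbed_by conf leak P x Z" if "i \<in> block_voters k m Z" for i Z
      using that Suc.IH[of i] by (simp add: block_voters_iff)
    have gp: "?g (policy k m Z) = of_bool (Z = P)" for Z
      using Suc.IH[of "policy k m Z"] policy_less[of k m Z] policy_eq_iff[of k m Z P] by (cases Z) (auto simp del: policy_eq_iff)
    have "(\<Sum>i = 0..<k + m + 2. ?g i * ?V $$ (i, j)) = absorbed_by conf leak P (Suc x) (block_of k j)"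
      using sum_voting_matrix_column[where conf = conf and leak = leak and g = ?g,
          OF pos single voter_in_block_of[OF True] g g]
      unfolding gp absorbed_by.simps .
    then show ?thesis
      unfolding step using True by (simp only: if_True)
  next
    case False
    \<comment> \<open>A policy column is a unit vector, so the entry carries over unchanged.\<close>
    have "(\<Sum>i = 0..<k + m + 2. ?g i * ?V $$ (i, j)) = (\<Sum>i = 0..<k + m + 2. if i = j then ?g j else 0)"
      by (rule sum.cong) (use False Suc.prems in \<open>auto simp: voting_matrix_absorbing_column\<close>)
    then show ?thesis
      unfolding step using False Suc.prems Suc.IH[of j] by simp
  qed
qed

text \<open>Each new value is a convex combination of 0 or 1 and the previous values.\<close>

lemma absorbed_by_bounds:
  assumes c: "\<And>X. 0 \<le> conf X \<and> conf X \<le> 1" and l: "\<And>X. 0 \<le> leak X \<and> leak X \<le> 1"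
  shows "0 \<le> absorbed_by conf leak P x X" "absorbed_by conf leak P x X \<le> 1"
proof -
  have "0 \<le> absorbed_by conf leak P x X \<and> absorbed_by conf leak P x X \<le> 1"
  proof (induction x arbitrary: X)
    case (Suc x)
    let ?u = "leak X * absorbed_by conf leak P x (other_block X)
      + (1 - leak X) * absorbed_by conf leak P x X"
    have u: "0 \<le> ?u" "?u \<le> 1"
      using Suc.IH l[of X] by (auto intro!: add_nonneg_nonneg mult_nonneg_nonneg convex_bound_le)
    have "conf X * of_bool (X = P) + (1 - conf X) * ?u \<le> 1"
      by (rule convex_bound_le) (use u c[of X] in auto)
    with u c[of X] show ?case by simp
  qed simp
  then show "0 \<le> absorbed_by conf leak P x X" "absorbed_by conf leak P x X \<le> 1" by auto
qed

text \<open>The recurrence has nonnegative coefficients, hence preserves order, and it starts at 0,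
  below its first iterate.\<close>

lemma absorbed_by_mono:
  assumes c: "\<And>X. 0 \<le> conf X \<and> conf X \<le> 1" and l: "\<And>X. 0 \<le> leak X \<and> leak X \<le> 1"
  shows "absorbed_by conf leak P x X \<le> absorbed_by conf leak P (Suc x) X"
proof (induction x arbitrary: X)
  case 0
  then show ?case using c by simp
next
  case (Suc x)
  have "leak X * absorbed_by conf leak P x (other_block X) + (1 - leak X) * absorbed_by conf leak P x X
    \<le> leak X * absorbed_by conf leak P (Suc x) (other_block X)
      + (1 - leak X) * absorbed_by conf leak P (Suc x) X"
    by (intro add_mono mult_left_mono Suc.IH) (use l[of X] in simp_all)
  from mult_left_mono[OF this, of "1 - conf X"] show ?case
    unfolding absorbed_by.simps(2)[of conf leak P "Suc x"] using c[of X]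
    by (subst absorbed_by.simps(2)) linarith
qed

text \<open>Adding \<open>1 + t\<close> times the first equation to \<open>s\<close> times the
  second eliminates \<open>v\<close>.\<close>

lemma two_block_system:
  fixes u v s t a b :: real
  assumes "u * (1 + s) = a + s * v" and "v * (1 + t) = b + t * u"
  shows "u * (1 + s + t) = a * (1 + t) + s * b"
proof -
  have "u * (1 + s + t) - (a * (1 + t) + s * b) =
      (1 + t) * (u * (1 + s) - (a + s * v)) + s * (v * (1 + t) - (b + t * u))"
    by (simp add: algebra_simps)
  then show ?thesis using assms by simp
qed

lemma absorbed_by_limit:
  assumes c: "\<And>X. 0 < conf X \<and> conf X \<le> 1" and l: "\<And>X. 0 \<le> leak X \<and> leak X \<le> 1"
  defines "w \<equiv> \<lambda>X. delegation_odds conf X * leak X"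
  shows "(\<lambda>x. absorbed_by conf leak P x X)
    \<longlonglongrightarrow> (of_bool (X = P) + w (other_block P)) / (1 + w BlockA + w BlockB)"
proof -
  have c': "0 \<le> conf X \<and> conf X \<le> 1" for X using c[of X] by auto
  let ?h = "absorbed_by conf leak P"
  have "\<exists>L. (\<lambda>x. ?h x X) \<longlonglongrightarrow> L" for X
  proof -
    have "incseq (\<lambda>x. ?h x X)" using absorbed_by_mono[where conf = conf and leak = leak, OF c' l] by (rule incseq_SucI)
    moreover have "\<forall>x. ?h x X \<le> 1" using absorbed_by_bounds(2)[where conf = conf and leak = leak, OF c' l] by (rule allI)
    ultimately obtain L where "(\<lambda>x. ?h x X) \<longlonglongrightarrow> L" by (rule incseq_convergent)
    then show ?thesis by (rule exI)
  qed
  then obtain L where L: "\<And>X. (\<lambda>x. ?h x X) \<longlonglongrightarrow> L X" by metis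
  have w: "0 \<le> w X" for X
    using c[of X] l[of X] by (simp add: w_def delegation_odds_def)
  have fixpoint: "L X * (1 + w X) = of_bool (X = P) + w X * L (other_block X)" for X
  proof -
    have "(\<lambda>x. ?h (Suc x) X) \<longlonglongrightarrow> conf X * of_bool (X = P) +
        (1 - conf X) * (leak X * L (other_block X) + (1 - leak X) * L X)"
      unfolding absorbed_by.simps by (intro tendsto_intros L)
    from LIMSEQ_unique[OF LIMSEQ_Suc[OF L] this]
    have "L X = conf X * of_bool (X = P) +
        (1 - conf X) * (leak X * L (other_block X) + (1 - leak X) * L X)" .
    \<comment> \<open>Collecting \<open>L X\<close> gives the coefficient
      \<open>1 - (1 - conf X) * (1 - leak X)\<close>, which equals
      \<open>conf X * (1 + w X)\<close>; dividing by \<open>conf X\<close> finishes.\<close>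
    then show ?thesis
      using c[of X] unfolding w_def delegation_odds_def by (simp add: field_simps)
  qed
  have A: "L BlockA * (1 + w BlockA) = of_bool (BlockA = P) + w BlockA * L BlockB"
    and B: "L BlockB * (1 + w BlockB) = of_bool (BlockB = P) + w BlockB * L BlockA"
    using fixpoint[of BlockA] fixpoint[of BlockB] by simp_all
  have D: "1 + w BlockA + w BlockB > 0" using w[of BlockA] w[of BlockB] by simp
  have "L BlockA * (1 + w BlockA + w BlockB) =
      of_bool (BlockA = P) * (1 + w BlockB) + w BlockA * of_bool (BlockB = P)"
    and "L BlockB * (1 + w BlockA + w BlockB) =
      of_bool (BlockB = P) * (1 + w BlockA) + w BlockB * of_bool (BlockA = P)"
    using two_block_system[OF A B] two_block_system[OF B A] by (simp_all add: algebra_simps)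
  \<comment> \<open>One formula covers both cases: if \<open>X\<close> differs from
    \<open>P\<close>, then \<open>X\<close> is \<open>other_block P\<close> and the numerator is
    \<open>w X\<close>.\<close>
  then have "L X * (1 + w BlockA + w BlockB) = of_bool (X = P) + w (other_block P)"
    by (cases X; cases P) simp_all
  then have "L X = (of_bool (X = P) + w (other_block P)) / (1 + w BlockA + w BlockB)"
    using D by (simp add: field_simps)
  with L show ?thesis by metis
qed

text \<open>In the sum over voters each one contributes \<open>w (other_block P)\<close> to the
  numerator, and those of block \<open>P\<close> contribute 1 more.\<close>

lemma absorbed_mass_eq:
  assumes pos: "1 \<le> k" "1 \<le> m"
    and c: "\<And>X. 0 < conf X \<and> conf X \<le> 1" and l: "\<And>X. 0 \<le> leak X \<and> leak X \<le> 1"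
    and single: "\<forall>X. card (block_voters k m X) = 1 \<longrightarrow> leak X = 1"
  defines "w \<equiv> \<lambda>X. delegation_odds conf X * leak X"
  shows "absorbed_mass k m conf leak P =
    (real (card (block_voters k m P)) + real (k + m) * w (other_block P)) / (1 + w BlockA + w BlockB)"
proof -
  let ?D = "1 + w BlockA + w BlockB"
  have entry: "limit_matrix k m conf leak $$ (policy k m P, j) =
      (of_bool (block_of k j = P) + w (other_block P)) / ?D" if "j < k + m" for j
    using that limI[OF absorbed_by_limit[where conf = conf and leak = leak and P = P and X = "block_of k j", OF c l]]
policy_less[of k m P]
    by (simp add: limit_matrix_def voting_matrix_power_row[where leak = leak, OF pos single] w_def)
  have "absorbed_mass k m conf leak P = (\<Sum>j<k + m. (of_bool (block_of k j = P) + w (other_block P)) / ?D)"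
    unfolding absorbed_mass_def by (rule sum.cong) (use entry in auto)
  also have "\<dots> = ((\<Sum>j<k + m. of_bool (block_of k j = P)) + real (k + m) * w (other_block P)) / ?D"
    by (simp add: sum_divide_distrib[symmetric] sum.distrib)
  also have "(\<Sum>j<k + m. of_bool (block_of k j = P) :: real) = real (card (block_voters k m P))"
  proof -
    have "{..<k + m} \<inter> {j. block_of k j = P} = block_voters k m P"
      by (auto simp: block_voters_iff)
    then show ?thesis by (simp add: sum_of_bool_eq)
  qed
  finally show ?thesis .
qed

theorem theorem1:
  fixes k m n :: nat
    and conf leak :: "block \<Rightarrow> real"
  assumes "n = k + m" and "k \<ge> m" and "m \<ge> 1"
    and "\<And>X. 0 < conf X \<and> conf X \<le> 1"
    and "\<And>X. 0 \<le> leak X \<and> leak X \<le> 1"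
    and "\<And>X. card (block_voters k m X) = 1 \<Longrightarrow> leak X = 1"
  shows "absorbed_mass k m conf leak BlockB > absorbed_mass k m conf leak BlockA \<longleftrightarrow>
    real n * (delegation_odds conf BlockA * leak BlockA
              - delegation_odds conf BlockB * leak BlockB) > real k - real m"
proof -
  have "1 \<le> k" using assms(2,3) by simp
  have "\<forall>X. card (block_voters k m X) = 1 \<longrightarrow> leak X = 1"
    using assms(6) by blast
  note mass = absorbed_mass_eq[where conf = conf and leak = leak, OF \<open>1 \<le> k\<close> assms(3-5) this]
  have w: "0 \<le> delegation_odds conf X * leak X" for X
    using assms(4)[of X] assms(5)[of X] by (simp add: delegation_odds_def)
  \<comment> \<open>Both masses have this denominator, so its positivity reduces the comparison to
    the numerators.\<close>
  have "0 < 1 + delegation_odds conf BlockA * leak BlockA + delegation_odds conf BlockB * leak BlockB"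
    using w[of BlockA] w[of BlockB] by simp
  then show ?thesis
    unfolding mass assms(1) by (simp add: divide_less_cancel algebra_simps)
qed

end
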